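(* Let $f_1:\mathbb{R}^d\to\mathbb{R}^m$ and $f_2:\mathbb{R}^m\to\mathbb{R}$ be in $\mathcal{C}^2$, $x_0\in\mathbb{R}^d$, $\bar\Delta>0$, and let $\{\widetilde f_{1,\Delta}\}_{\Delta\in(0,\bar\Delta]}$, $\{\widetilde f_{2,\Delta}\}_{\Delta\in(0,\bar\Delta]}$ be classes of (twice differentiable) models of $f_1$ and $f_2$. Put $F=f_2\circ f_1$ and $\widetilde F_\Delta=\widetilde f_{2,\Delta}\circ\widetilde f_{1,\Delta}$. Suppose $\{\widetilde f_{1,\Delta}\}_{(0,\bar\Delta]}$ provides order-$\infty$ function accuracy of $f_1$ at $x_0$ with constant $\kappa_1^f(x_0)=0$, order-$N_1^g$ gradient accuracy of $f_1$ at $x_0$ with constant $\kappa_1^g(x_0)$, and order-$N_1^h$ Hessian accuracy of $f_1$ at $x_0$ with constant $\kappa_1^h(x_0)$. Suppose $\{\widetilde f_{2,\Delta}\}_{(0,\bar\Delta]}$ provides order-$\infty$ function accuracy of $f_2$ at $f_1(x_0)$ with constant $\kappa_2^f(f_1(x_0))=0$, order-$N_2^g$ gradient accuracy of $f_2$ at $f_1(x_0)$ with constant $\kappa_2^g(f_1(x_0))$, and order-$N_2^h$ Hessian accuracy of $f_2$ at $f_1(x_0)$ with constant $\kappa_2^h(f_1(x_0))$. All orders are $\ge0$. Let $N_F^{gh}=\min\{N_1^g,N_2^g,N_1^h,N_2^h\}$. Then for every $\Delta\in(0,\bar\Delta]$ $$\|\nabla^2F(x_0)-\nabla^2\widetilde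 F_\Delta(x_0)\|\le K_F^h(x_0)\Delta^{N_F^{gh}},$$ where $$\begin{aligned}K_F^h(x_0)=&\,M_{\nabla^2\widetilde f_2}(f_1(x_0))\big(\|\nabla f_1(x_0)\|+M_{\nabla\widetilde f_1}(x_0)\big)\kappa_1^g(x_0)\bar\Delta^{N_1^g-N_F^{gh}}+M_{\nabla^2\widetilde f_1}(x_0)\kappa_2^g(f_1(x_0))\bar\Delta^{N_2^g-N_F^{gh}}\\&+\big(\|\nabla f_2(f_1(x_0))\|+M_{\nabla\widetilde f_2}(f_1(x_0))\big)\kappa_1^h(x_0)\bar\Delta^{N_1^h-N_F^{gh}}+\|\nabla f_1(x_0)\|^2\kappa_2^h(f_1(x_0))\bar\Delta^{N_2^h-N_F^{gh}}.\end{aligned}$$ In particular, $\{\widetilde F_\Delta\}_{(0,\bar\Delta]}$ provides order-$N_F^{gh}$ Hessian accuracy of $F$ at $x_0$.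
   Context: For a mapping $g:\mathbb{R}^d\to\mathbb{R}^m$, $\nabla g(x)$ denotes its $m\times d$ Jacobian matrix and $\nabla^2g(x)$ its second derivative, viewed as a bilinear map $\mathbb{R}^d\times\mathbb{R}^d\to\mathbb{R}^m$; for a scalar function $\nabla g$ and $\nabla^2g$ are the gradient vector and Hessian matrix. $\nabla f_2(f_1(x_0))$ is the gradient of $f_2$ evaluated at $f_1(x_0)$. $\|\cdot\|$ is the Euclidean norm for vectors and the induced operator norm for matrices and bilinear maps ($\|B\|=\sup_{\|u\|=\|w\|=1}\|B(u,w)\|$). A class of models of $f:\mathbb{R}^p\to\mathbb{R}^q$ is a family of mappings $\widetilde f_\Delta:\mathbb{R}^p\to\mathbb{R}^q$ indexed by $\Delta\in(0,\bar\Delta]$; when first or second derivatives of models appear the models are understood to be differentiable, respectively twice differentiable. Order-$\infty$ function accuracy of $f$ at a point $y$ with constant $0$ means $\widetilde f_\Delta(y)=f(y)$ for all $\Delta\in(0,\bar\Delta]$. For real $N\ge0$ and $\kappa\ge0$, the class provides order-$N$ gradient (respectively Hessian) accuracy of $f$ at $y$ with constant $\kappa$ if $\|\nabla f(y)-\nabla\widetilde f_\Delta(y)\|\le\kappa\Delta^N$ (respectively $\|\nabla^2f(y)-\nabla^2\widetilde f_\Delta(y)\|\le\kappa\Delta^N$) for all $\Delta\in(0,\bar\Delta]$. Without mention of a constant, it is meant that some such $\kappa\ge0$ exists. Bounds (which exist under the hypotheses): $M_{\nabla\widetilde f_1}(x_0)$, $M_{\nabla^2\widetilde f_1}(x_0)$,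 $M_{\nabla\widetilde f_2}(f_1(x_0))$, $M_{\nabla^2\widetilde f_2}(f_1(x_0))$ denote numbers that bound, for all $\Delta\in(0,\bar\Delta]$, the quantities $\|\nabla\widetilde f_{1,\Delta}(x_0)\|$, $\|\nabla^2\widetilde f_{1,\Delta}(x_0)\|$, $\|\nabla\widetilde f_{2,\Delta}(f_1(x_0))\|$, $\|\nabla^2\widetilde f_{2,\Delta}(f_1(x_0))\|$ respectively. *)

theory Defs
  imports "HOL-Analysis.Analysis"
begin

text \<open>The library \<open>norm\<close> on \<^typ>\<open>real^'n^'m\<close> is the Frobenius norm, so the
  norm induced by the Euclidean norms is introduced separately.\<close>

definition matrix_norm :: "real^'n^'m \<Rightarrow> real" where
  "matrix_norm A = onorm (\<lambda>v. A *v v)"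

definition bilinear_norm :: "(real^'n \<Rightarrow> real^'n \<Rightarrow> real^'m) \<Rightarrow> real" where
  "bilinear_norm B = (SUP (u, w) \<in> {(u, w). norm u = 1 \<and> norm w = 1}. norm (B u w))"

definition gradient :: "(real^'n \<Rightarrow> real) \<Rightarrow> real^'n \<Rightarrow> real^'n" where
  "gradient g x = (\<chi> i. frechet_derivative g (at x) (axis i 1))"

definition hessian :: "(real^'n \<Rightarrow> real) \<Rightarrow> real^'n \<Rightarrow> real^'n^'n" where
  "hessian g x = jacobian (gradient g) (at x)"

text \<open>The derivative of the map \<open>y \<mapsto> jacobian g (at y)\<close> at \<open>x\<close> in direction \<open>u\<close> is a
  matrix; applying it to \<open>w\<close> gives the second derivative as a bilinear map in \<open>u, w\<close>.\<close>

definition second_derivative ::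
    "(real^'n \<Rightarrow> real^'m) \<Rightarrow> real^'n \<Rightarrow> real^'n \<Rightarrow> real^'n \<Rightarrow> real^'m" where
  "second_derivative g x u w = frechet_derivative (\<lambda>y. jacobian g (at y)) (at x) u *v w"

definition twice_differentiable :: "(real^'n \<Rightarrow> real^'m) \<Rightarrow> bool" where
  "twice_differentiable g \<longleftrightarrow>
     (\<forall>x. g differentiable (at x)) \<and> (\<forall>x. (\<lambda>y. jacobian g (at y)) differentiable (at x))"

definition twice_differentiable_scalar :: "(real^'n \<Rightarrow> real) \<Rightarrow> bool" where
  "twice_differentiable_scalar g \<longleftrightarrow>
     (\<forall>x. g differentiable (at x)) \<and> (\<forall>x. gradient g differentiable (at x))"

text \<open>In finite dimension, continuity of the bilinear-map-valued second derivative is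
  continuity of its value on each pair of vectors.\<close>

definition C2 :: "(real^'n \<Rightarrow> real^'m) \<Rightarrow> bool" where
  "C2 g \<longleftrightarrow> twice_differentiable g \<and>
     (\<forall>u w. continuous_on UNIV (\<lambda>x. second_derivative g x u w))"

definition C2_scalar :: "(real^'n \<Rightarrow> real) \<Rightarrow> bool" where
  "C2_scalar g \<longleftrightarrow> twice_differentiable_scalar g \<and> continuous_on UNIV (hessian g)"

text \<open>In the following, \<open>ft \<Delta>\<close> for \<open>0 < \<Delta> \<le> \<Delta>b\<close> is a class of models of \<open>f\<close>; the values
  of \<open>ft\<close> outside this range are irrelevant. The accuracy notions include the requirement that
  the models have the derivatives in question.\<close>

text \<open>Function accuracy of order infinity with constant \<open>0\<close>:\<close>

definition exact_function_accuracy ::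
    "(real \<Rightarrow> 'a \<Rightarrow> 'b) \<Rightarrow> real \<Rightarrow> ('a \<Rightarrow> 'b) \<Rightarrow> 'a \<Rightarrow> bool" where
  "exact_function_accuracy ft \<Delta>b f y \<longleftrightarrow> (\<forall>\<Delta>\<in>{0<..\<Delta>b}. ft \<Delta> y = f y)"

definition gradient_accuracy ::
    "(real \<Rightarrow> real^'n \<Rightarrow> real^'m) \<Rightarrow> real \<Rightarrow> (real^'n \<Rightarrow> real^'m) \<Rightarrow> real^'n \<Rightarrow> real \<Rightarrow> real \<Rightarrow> bool"
  where
  "gradient_accuracy ft \<Delta>b f y N \<kappa> \<longleftrightarrow>
     (\<forall>\<Delta>\<in>{0<..\<Delta>b}. (\<forall>x. ft \<Delta> differentiable (at x)) \<and>
        matrix_norm (jacobian f (at y) - jacobian (ft \<Delta>) (at y)) \<le> \<kappa> * \<Delta> powr N)"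

definition hessian_accuracy ::
    "(real \<Rightarrow> real^'n \<Rightarrow> real^'m) \<Rightarrow> real \<Rightarrow> (real^'n \<Rightarrow> real^'m) \<Rightarrow> real^'n \<Rightarrow> real \<Rightarrow> real \<Rightarrow> bool"
  where
  "hessian_accuracy ft \<Delta>b f y N \<kappa> \<longleftrightarrow>
     (\<forall>\<Delta>\<in>{0<..\<Delta>b}. twice_differentiable (ft \<Delta>) \<and>
        bilinear_norm (\<lambda>u w. second_derivative f y u w - second_derivative (ft \<Delta>) y u w)
          \<le> \<kappa> * \<Delta> powr N)"

definition gradient_accuracy_scalar ::
    "(real \<Rightarrow> real^'n \<Rightarrow> real) \<Rightarrow> real \<Rightarrow> (real^'n \<Rightarrow> real) \<Rightarrow> real^'n \<Rightarrow> real \<Rightarrow> real \<Rightarrow> bool" where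
  "gradient_accuracy_scalar ft \<Delta>b f y N \<kappa> \<longleftrightarrow>
     (\<forall>\<Delta>\<in>{0<..\<Delta>b}. (\<forall>x. ft \<Delta> differentiable (at x)) \<and>
        norm (gradient f y - gradient (ft \<Delta>) y) \<le> \<kappa> * \<Delta> powr N)"

definition hessian_accuracy_scalar ::
    "(real \<Rightarrow> real^'n \<Rightarrow> real) \<Rightarrow> real \<Rightarrow> (real^'n \<Rightarrow> real) \<Rightarrow> real^'n \<Rightarrow> real \<Rightarrow> real \<Rightarrow> bool" where
  "hessian_accuracy_scalar ft \<Delta>b f y N \<kappa> \<longleftrightarrow>
     (\<forall>\<Delta>\<in>{0<..\<Delta>b}. twice_differentiable_scalar (ft \<Delta>) \<and>
        matrix_norm (hessian f y - hessian (ft \<Delta>) y) \<le> \<kappa> * \<Delta> powr N)"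

end

theory Submission
  imports Defs
begin

text \<open>Write \<open>J\<close>, \<open>B\<close> for the first and second derivative of \<open>f1\<close> at \<open>x0\<close> and \<open>g\<close>, \<open>H\<close> for
  the gradient and Hessian of \<open>f2\<close> at \<open>f1 x0\<close>. The Hessian of \<open>f2 \<circ> f1\<close> at \<open>x0\<close> is the bilinear
  form \<open>(u, w) \<mapsto> J w \<bullet> H (J u) + g \<bullet> B u w\<close>. Since the models reproduce the value of \<open>f1\<close> at
  \<open>x0\<close>, their derivatives enter the same formula at the same points, and the error telescopes
  into terms that contain a single difference each.\<close>

section \<open>Operator norms of matrices\<close>

lemma norm_matrix_vector_le: "norm (A *v v) \<le> matrix_norm A * norm v"
  unfolding matrix_norm_def by (rule onorm) (rule matrix_vector_mul_bounded_linear)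

lemma matrix_norm_nonneg: "0 \<le> matrix_norm A"
  unfolding matrix_norm_def by (rule onorm_pos_le) (rule matrix_vector_mul_bounded_linear)

text \<open>Testing with \<open>w = A *v u\<close> puts the square of \<open>norm (A *v u)\<close>
  on the left, and one factor cancels. This reduces an operator norm to the scalar form in which the
  Hessian of a composition is computed.\<close>

lemma matrix_norm_le_inner:
  assumes "\<And>u w. \<bar>w \<bullet> (A *v u)\<bar> \<le> C * norm u * norm w"
  shows "matrix_norm A \<le> C"
  unfolding matrix_norm_def
proof (rule onorm_le)
  fix u
  have "norm (A *v u) * norm (A *v u) \<le> (C * norm u) * norm (A *v u)"
    using assms[of "A *v u" u] by (simp add: dot_square_norm power2_eq_square)
  \<comment> \<open>If \<open>A *v u = 0\<close>, nothing can be cancelled; the claim is then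
    exactly this inequality, obtained from any unit vector \<open>w\<close>.\<close>
  moreover have "0 \<le> C * norm u"
  proof -
    obtain w :: "real^'b" where "norm w = 1"
      using vector_choose_size[of 1] by auto
    then show ?thesis using assms[of w u] by simp
  qed
  ultimately show "norm (A *v u) \<le> C * norm u"
    by (cases "norm (A *v u) = 0") auto
qed

text \<open>Triangle inequality for \<open>B = A - (A - B)\<close>. With \<open>A\<close> exact and
  \<open>B\<close> from a model, it bounds the model derivative by a fixed number plus the
  error.\<close>

lemma matrix_norm_le_add_diff: "matrix_norm B \<le> matrix_norm A + matrix_norm (A - B)"
  unfolding matrix_norm_def[of B]
proof (rule onorm_le)
  fix v
  have "B *v v = A *v v - (A - B) *v v"
    by (simp add: matrix_vector_mult_diff_rdistrib)
  also have "norm \<dots> \<le> norm (A *v v) + norm ((A - B) *v v)"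
    by (rule norm_triangle_ineq4)
  also have "\<dots> \<le> (matrix_norm A + matrix_norm (A - B)) * norm v"
    using norm_matrix_vector_le[of A v] norm_matrix_vector_le[of "A - B" v]
    by (simp add: distrib_right)
  finally show "norm (B *v v) \<le> (matrix_norm A + matrix_norm (A - B)) * norm v" .
qed

section \<open>Norms of bilinear maps\<close>

text \<open>A real \<open>SUP\<close> dominates the elements of a set that is bounded above; the
  constant \<open>K\<close> of a bounded bilinear map provides such a bound.\<close>

lemma norm_bilinear_unit_le:
  fixes B :: "real^'n \<Rightarrow> real^'n \<Rightarrow> real^'m"
  assumes "bounded_bilinear B" "norm u = 1" "norm w = 1"
  shows "norm (B u w) \<le> bilinear_norm B"
proof -
  obtain K where K: "\<And>a b. norm (B a b) \<le> norm a * norm b * K"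
    using bounded_bilinear.bounded[OF assms(1)] by blast
  have "bdd_above ((\<lambda>(u, w). norm (B u w)) ` {(u, w). norm u = 1 \<and> norm w = 1})"
    by (rule bdd_aboveI[of _ K]) (use K in \<open>auto; metis mult_1\<close>)
  from cSUP_upper[OF _ this, of "(u, w)"] show ?thesis
    unfolding bilinear_norm_def using assms by simp
qed

lemma bilinear_norm_nonneg:
  fixes B :: "real^'n \<Rightarrow> real^'n \<Rightarrow> real^'m"
  assumes "bounded_bilinear B"
  shows "0 \<le> bilinear_norm B"
proof -
  obtain w :: "real^'n" where "norm w = 1"
    using vector_choose_size[of 1] by auto
  then show ?thesis
    using norm_bilinear_unit_le[OF assms, of w w] norm_ge_zero order_trans by blast
qed

text \<open>Homogeneity in each argument reduces the claim to unit vectors; zero arguments cannot be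
  normalised and are treated apart.\<close>

lemma norm_bilinear_le:
  fixes B :: "real^'n \<Rightarrow> real^'n \<Rightarrow> real^'m"
  assumes "bounded_bilinear B"
  shows "norm (B u w) \<le> bilinear_norm B * norm u * norm w"
proof (cases "u = 0 \<or> w = 0")
  case True
  then show ?thesis
    by (auto simp: bounded_bilinear.zero_left[OF assms] bounded_bilinear.zero_right[OF assms])
next
  case False
  have "B u w = (norm u * norm w) *\<^sub>R B (u /\<^sub>R norm u) (w /\<^sub>R norm w)"
    using False by (simp add: bounded_bilinear.scaleR_left[OF assms]
        bounded_bilinear.scaleR_right[OF assms] field_simps)
  moreover have "norm (B (u /\<^sub>R norm u) (w /\<^sub>R norm w)) \<le> bilinear_norm B"
    using False by (intro norm_bilinear_unit_le assms) auto
  then have "(norm u * norm w) * norm (B (u /\<^sub>R norm u) (w /\<^sub>R norm w))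
      \<le> (norm u * norm w) * bilinear_norm B"
    by (intro mult_left_mono) simp_all
  ultimately show ?thesis
    by (simp add: mult_ac)
qed

lemma bounded_bilinear_diff:
  fixes B C :: "real^'n \<Rightarrow> real^'n \<Rightarrow> real^'m"
  assumes "bounded_bilinear B" "bounded_bilinear C"
  shows "bounded_bilinear (\<lambda>u w. B u w - C u w)"
  using assms unfolding bilinear_conv_bounded_bilinear[symmetric] bilinear_def
  by (auto intro: linear_compose_sub)

text \<open>Bilinear counterpart of \<open>matrix_norm_le_add_diff\<close>, with the triangle
  inequality applied at each pair of unit vectors.\<close>

lemma bilinear_norm_le_add_diff:
  fixes B C :: "real^'n \<Rightarrow> real^'n \<Rightarrow> real^'m"
  assumes "bounded_bilinear B" "bounded_bilinear C"
  shows "bilinear_norm C \<le> bilinear_norm B + bilinear_norm (\<lambda>u w. B u w - C u w)"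
  unfolding bilinear_norm_def[of C]
proof (rule cSUP_least)
  obtain w :: "real^'n" where "norm w = 1"
    using vector_choose_size[of 1] by auto
  then show "{(u, w). norm (u::real^'n) = 1 \<and> norm (w::real^'n) = 1} \<noteq> {}"
    by blast
next
  fix p :: "(real^'n) \<times> (real^'n)"
  assume "p \<in> {(u, w). norm u = 1 \<and> norm w = 1}"
  then obtain u w where p: "p = (u, w)" "norm u = 1" "norm w = 1" by auto
  have "norm (C u w) \<le> norm (B u w) + norm (B u w - C u w)"
    by (metis diff_diff_eq2 add_diff_cancel_left' norm_triangle_ineq4)
  also have "\<dots> \<le> bilinear_norm B + bilinear_norm (\<lambda>u w. B u w - C u w)"
    using norm_bilinear_unit_le[OF assms(1) p(2,3)]
      norm_bilinear_unit_le[OF bounded_bilinear_diff[OF assms] p(2,3)] by simp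
  finally show "(case p of (u, w) \<Rightarrow> norm (C u w))
      \<le> bilinear_norm B + bilinear_norm (\<lambda>u w. B u w - C u w)"
    by (simp add: p)
qed

section \<open>Bilinearity of second derivatives\<close>

text \<open>In finite dimension bilinearity implies boundedness. This gives access to the product
  rule for \<open>*v\<close>.\<close>

lemma bounded_bilinear_matrix_vector_mult:
  "bounded_bilinear ((*v) :: real^'n^'m \<Rightarrow> real^'n \<Rightarrow> real^'m)"
  by (subst bilinear_conv_bounded_bilinear[symmetric])
    (auto simp: bilinear_def intro!: linearI matrix_vector_right_distrib
      matrix_vector_mult_add_rdistrib scaleR_matrix_vector_assoc[symmetric]
      matrix_vector_mult_scaleR)

text \<open>The derivative of the Jacobian is linear in \<open>u\<close> and enters the left
  argument of the bilinear \<open>*v\<close>.\<close>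

lemma bounded_bilinear_second_derivative:
  assumes "twice_differentiable g"
  shows "bounded_bilinear (second_derivative g x)"
proof -
  have "bounded_linear (frechet_derivative (\<lambda>y. jacobian g (at y)) (at x))"
    using assms unfolding twice_differentiable_def
    by (meson frechet_derivative_works has_derivative_bounded_linear)
  from bounded_bilinear.comp1[OF bounded_bilinear_matrix_vector_mult this]
  show ?thesis
    by (simp add: second_derivative_def[abs_def])
qed

section \<open>Gradient and Hessian of a composition\<close>

text \<open>By linearity the derivative is determined by its values on the standard basis, which are
  the entries of the gradient.\<close>

lemma has_derivative_gradient:
  assumes "g differentiable (at x)"
  shows "(g has_derivative (\<lambda>h. gradient g x \<bullet> h)) (at x)"
proof -
  let ?D = "frechet_derivative g (at x)"
  have D: "(g has_derivative ?D) (at x)"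
    using assms frechet_derivative_works by blast
  then interpret linear ?D
    by (rule has_derivative_linear)
  have "?D h = gradient g x \<bullet> h" for h
  proof -
    have "?D h = ?D (\<Sum>i\<in>UNIV. h $ i *\<^sub>R axis i 1)"
      by (subst basis_expansion[symmetric, of h]) (simp add: scalar_mult_eq_scaleR)
    also have "\<dots> = gradient g x \<bullet> h"
      by (simp add: sum scaleR gradient_def inner_vec_def mult.commute)
    finally show ?thesis .
  qed
  then have "?D = (\<lambda>h. gradient g x \<bullet> h)" by blast
  with D show ?thesis by simp
qed

lemma gradient_eqI:
  assumes "(g has_derivative (\<lambda>h. v \<bullet> h)) (at x)"
  shows "gradient g x = v"
  by (simp add: gradient_def vec_eq_iff frechet_derivative_at[OF assms, symmetric] inner_axis)

text \<open>The chain rule gives the derivative \<open>h\<close> to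
  \<open>gradient f2 (f1 x) \<bullet> (J *v h)\<close>; moving the Jacobian \<open>J\<close> across
  the inner product transposes it.\<close>

lemma gradient_compose:
  fixes f1 :: "real^'d \<Rightarrow> real^'m"
  assumes "f1 differentiable (at x)" "f2 differentiable (at (f1 x))"
  shows "gradient (f2 \<circ> f1) x = transpose (jacobian f1 (at x)) *v gradient f2 (f1 x)"
proof (rule gradient_eqI)
  have "(f2 \<circ> f1 has_derivative (\<lambda>h. gradient f2 (f1 x) \<bullet> h) \<circ> (\<lambda>h. jacobian f1 (at x) *v h)) (at x)"
    using assms by (intro diff_chain_at has_derivative_gradient) (simp_all add: jacobian_works)
  then show "(f2 \<circ> f1 has_derivative
      (\<lambda>h. (transpose (jacobian f1 (at x)) *v gradient f2 (f1 x)) \<bullet> h)) (at x)"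
    by (simp add: o_def dot_lmul_matrix[symmetric])
qed

text \<open>Product rule for the transposed Jacobian times the gradient of \<open>f2\<close> along
  \<open>f1\<close>: the first summand differentiates the gradient, the second the Jacobian.\<close>

lemma has_derivative_gradient_compose:
  fixes f1 :: "real^'d \<Rightarrow> real^'m"
  assumes f1: "twice_differentiable f1" and f2: "twice_differentiable_scalar f2"
  shows "(gradient (f2 \<circ> f1) has_derivative
      (\<lambda>u. transpose (jacobian f1 (at x)) *v (hessian f2 (f1 x) *v (jacobian f1 (at x) *v u))
         + transpose (frechet_derivative (\<lambda>y. jacobian f1 (at y)) (at x) u) *v gradient f2 (f1 x)))
      (at x)"
proof -
  let ?J = "\<lambda>y. jacobian f1 (at y)"
  have J: "(?J has_derivative frechet_derivative ?J (at x)) (at x)"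
    using f1 by (simp add: twice_differentiable_def frechet_derivative_works)
  have f1': "(f1 has_derivative (\<lambda>h. ?J x *v h)) (at x)"
    using f1 by (simp add: twice_differentiable_def jacobian_works)
  have g: "(gradient f2 has_derivative (\<lambda>h. hessian f2 (f1 x) *v h)) (at (f1 x))"
    using f2 by (simp add: twice_differentiable_scalar_def hessian_def jacobian_works)
  have tr: "bounded_linear (transpose :: real^'d^'m \<Rightarrow> real^'m^'d)"
    by (rule linear_conv_bounded_linear[THEN iffD1])
      (auto intro!: linearI simp: transpose_def vec_eq_iff)
  \<comment> \<open>The formula is needed at every \<open>y\<close>, since it is about to be
    differentiated.\<close>
  have gradient: "gradient (f2 \<circ> f1) = (\<lambda>y. transpose (?J y) *v (gradient f2 \<circ> f1) y)"
    using f1 f2 by (simp add: fun_eq_iff gradient_compose twice_differentiable_def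
        twice_differentiable_scalar_def)
  from bounded_bilinear.FDERIV[OF bounded_bilinear_matrix_vector_mult
      bounded_linear.has_derivative[OF tr J] diff_chain_at[OF f1' g]]
  show ?thesis
    unfolding gradient by (simp add: o_def)
qed

lemma twice_differentiable_scalar_compose:
  assumes "twice_differentiable f1" "twice_differentiable_scalar f2"
  shows "twice_differentiable_scalar (f2 \<circ> f1)"
  using assms has_derivative_gradient_compose[OF assms]
  unfolding twice_differentiable_scalar_def twice_differentiable_def
  by (blast intro: differentiable_chain_at differentiableI)

text \<open>Uniqueness of the derivative identifies the Hessian with the product rule expression;
  pairing with \<open>w\<close> moves both transposes onto \<open>w\<close>. Here \<open>u\<close>
  is the direction of differentiation of the Jacobian.\<close>

lemma inner_hessian_compose:
  assumes "twice_differentiable f1" "twice_differentiable_scalar f2"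
  shows "w \<bullet> (hessian (f2 \<circ> f1) x *v u) =
    (jacobian f1 (at x) *v w) \<bullet> (hessian f2 (f1 x) *v (jacobian f1 (at x) *v u))
    + gradient f2 (f1 x) \<bullet> second_derivative f1 x u w"
proof -
  have transpose: "w \<bullet> (v v* A) = (A *v w) \<bullet> v" for v and A :: "real^'a^'b"
    by (metis dot_lmul_matrix inner_commute)
  have "gradient (f2 \<circ> f1) differentiable (at x)"
    using twice_differentiable_scalar_compose[OF assms]
    by (simp add: twice_differentiable_scalar_def)
  then have "(gradient (f2 \<circ> f1) has_derivative (\<lambda>u. hessian (f2 \<circ> f1) x *v u)) (at x)"
    by (simp add: hessian_def jacobian_works)
  from has_derivative_unique[OF this has_derivative_gradient_compose[OF assms]]
  have "hessian (f2 \<circ> f1) x *v u =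
      transpose (jacobian f1 (at x)) *v (hessian f2 (f1 x) *v (jacobian f1 (at x) *v u))
      + transpose (frechet_derivative (\<lambda>y. jacobian f1 (at y)) (at x) u) *v gradient f2 (f1 x)"
    by (rule fun_cong)
  then show ?thesis
    by (simp add: inner_add_right transpose second_derivative_def inner_commute)
qed

section \<open>Hessian error for a single pair of models\<close>

lemma matrix_norm_hessian_compose_diff_le:
  fixes f1 t1 :: "real^'d \<Rightarrow> real^'m" and f2 t2 :: "real^'m \<Rightarrow> real" and x :: "real^'d"
  assumes f1: "twice_differentiable f1" and f2: "twice_differentiable_scalar f2"
    and t1: "twice_differentiable t1" and t2: "twice_differentiable_scalar t2"
    and same: "t1 x = f1 x"
  defines "J \<equiv> jacobian f1 (at x)" and "J' \<equiv> jacobian t1 (at x)"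
    and "B \<equiv> second_derivative f1 x" and "B' \<equiv> second_derivative t1 x"
    and "g \<equiv> gradient f2 (f1 x)" and "g' \<equiv> gradient t2 (f1 x)"
    and "H \<equiv> hessian f2 (f1 x)" and "H' \<equiv> hessian t2 (f1 x)"
  shows "matrix_norm (hessian (f2 \<circ> f1) x - hessian (t2 \<circ> t1) x) \<le>
      matrix_norm H' * (matrix_norm J + matrix_norm J') * matrix_norm (J - J')
      + bilinear_norm B' * norm (g - g')
      + norm g * bilinear_norm (\<lambda>u w. B u w - B' u w)
      + (matrix_norm J)\<^sup>2 * matrix_norm (H - H')" (is "_ \<le> ?C")
proof (rule matrix_norm_le_inner)
  fix u w
  have bB: "bounded_bilinear B" "bounded_bilinear B'"
    by (simp_all add: B_def B'_def bounded_bilinear_second_derivative f1 t1)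
  \<comment> \<open>Cauchy-Schwarz followed by the operator norm bound of each of the three
    matrices.\<close>
  have form: "\<bar>(P *v w) \<bullet> (Q *v (R *v u))\<bar> \<le>
      matrix_norm P * matrix_norm Q * matrix_norm R * (norm u * norm w)"
    for P R :: "real^'d^'m" and Q :: "real^'m^'m"
  proof -
    have "norm (Q *v (R *v u)) \<le> matrix_norm Q * (matrix_norm R * norm u)"
      by (meson matrix_norm_nonneg mult_left_mono norm_matrix_vector_le order_trans)
    then have "norm (P *v w) * norm (Q *v (R *v u)) \<le>
        (matrix_norm P * norm w) * (matrix_norm Q * (matrix_norm R * norm u))"
      by (intro mult_mono norm_matrix_vector_le) (auto simp: matrix_norm_nonneg)
    with Cauchy_Schwarz_ineq2[of "P *v w" "Q *v (R *v u)"] show ?thesis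
      by (simp add: mult_ac)
  qed
  have inner: "\<bar>v \<bullet> T u w\<bar> \<le> norm v * bilinear_norm T * (norm u * norm w)"
    if "bounded_bilinear T" for T :: "real^'d \<Rightarrow> real^'d \<Rightarrow> real^'m" and v
    using Cauchy_Schwarz_ineq2[of v "T u w"]
      mult_left_mono[OF norm_bilinear_le[OF that, of u w] norm_ge_zero[of v]]
    by (simp add: mult_ac)
  have "w \<bullet> ((hessian (f2 \<circ> f1) x - hessian (t2 \<circ> t1) x) *v u) =
      (J *v w) \<bullet> (H *v (J *v u)) + g \<bullet> B u w - ((J' *v w) \<bullet> (H' *v (J' *v u)) + g' \<bullet> B' u w)"
    by (simp add: matrix_vector_mult_diff_rdistrib inner_diff_right
        inner_hessian_compose[OF f1 f2] inner_hessian_compose[OF t1 t2] same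
        J_def J'_def B_def B'_def g_def g'_def H_def H'_def)
  \<comment> \<open>\<open>H\<close> is exchanged first, then the right and the left
    \<open>J\<close>. Hence \<open>H - H'\<close> meets two exact Jacobians, while \<open>H'\<close>
    meets \<open>J\<close> once and \<open>J'\<close> once, which produces the sum of their norms in
    the bound.\<close>
  also have "\<dots> = (J *v w) \<bullet> ((H - H') *v (J *v u)) + (J *v w) \<bullet> (H' *v ((J - J') *v u))
      + ((J - J') *v w) \<bullet> (H' *v (J' *v u)) + g \<bullet> (B u w - B' u w) + (g - g') \<bullet> B' u w"
    by (simp add: matrix_vector_mult_diff_rdistrib matrix_vector_mult_diff_distrib
        inner_diff_right inner_diff_left)
  finally have "\<bar>w \<bullet> ((hessian (f2 \<circ> f1) x - hessian (t2 \<circ> t1) x) *v u)\<bar> \<le>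
      \<bar>(J *v w) \<bullet> ((H - H') *v (J *v u))\<bar> + \<bar>(J *v w) \<bullet> (H' *v ((J - J') *v u))\<bar>
      + \<bar>((J - J') *v w) \<bullet> (H' *v (J' *v u))\<bar> + \<bar>g \<bullet> (B u w - B' u w)\<bar> + \<bar>(g - g') \<bullet> B' u w\<bar>"
    by linarith
  also have "\<dots> \<le> matrix_norm J * matrix_norm (H - H') * matrix_norm J * (norm u * norm w)
      + matrix_norm J * matrix_norm H' * matrix_norm (J - J') * (norm u * norm w)
      + matrix_norm (J - J') * matrix_norm H' * matrix_norm J' * (norm u * norm w)
      + norm g * bilinear_norm (\<lambda>u w. B u w - B' u w) * (norm u * norm w)
      + norm (g - g') * bilinear_norm B' * (norm u * norm w)"
    by (intro add_mono form inner bB inner[OF bounded_bilinear_diff[OF bB]])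
  also have "\<dots> = ?C * norm u * norm w"
    by (simp add: algebra_simps power2_eq_square)
  finally show "\<bar>w \<bullet> ((hessian (f2 \<circ> f1) x - hessian (t2 \<circ> t1) x) *v u)\<bar> \<le> ?C * norm u * norm w" .
qed

section \<open>Uniformity in the model parameter\<close>

text \<open>For \<open>N \<ge> 0\<close> the error bound is largest at \<open>\<Delta> = b\<close>.
  With \<open>c\<close> the norm of an exact derivative and \<open>e\<close> the error, this yields
  the uniform bounds on the model derivatives.\<close>

lemma bdd_above_accuracy:
  fixes \<phi> e :: "real \<Rightarrow> real"
  assumes "\<And>\<Delta>. \<Delta> \<in> {0<..b} \<Longrightarrow> \<phi> \<Delta> \<le> c + e \<Delta>"
    and "\<And>\<Delta>. \<Delta> \<in> {0<..b} \<Longrightarrow> e \<Delta> \<le> \<kappa> * \<Delta> powr N" and "0 \<le> N" "0 \<le> \<kappa>"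
  shows "bdd_above (\<phi> ` {0<..b})"
proof (rule bdd_aboveI2)
  fix \<Delta> assume \<Delta>: "\<Delta> \<in> {0<..b}"
  then have "\<kappa> * \<Delta> powr N \<le> \<kappa> * b powr N"
    using assms by (intro mult_left_mono powr_mono2) auto
  with assms(1,2)[OF \<Delta>] show "\<phi> \<Delta> \<le> c + \<kappa> * b powr N" by simp
qed

text \<open>Splitting off the surplus power \<open>\<Delta> powr (N - n)\<close> and bounding it at
  \<open>b\<close> lowers an order to the common one; this is the origin of the powers of
  \<open>\<Delta>b\<close> in the final constant.\<close>

lemma accuracy_order_mono:
  fixes \<Delta> b :: real
  assumes "e \<le> \<kappa> * \<Delta> powr N" "0 < \<Delta>" "\<Delta> \<le> b" "n \<le> N" "0 \<le> \<kappa>"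
  shows "e \<le> \<kappa> * b powr (N - n) * \<Delta> powr n"
proof -
  have "\<Delta> powr N = \<Delta> powr (N - n) * \<Delta> powr n"
    by (simp add: powr_add[symmetric])
  also have "\<dots> \<le> b powr (N - n) * \<Delta> powr n"
    using assms by (intro mult_right_mono powr_mono2) auto
  finally show ?thesis
    using assms(1,5) by (smt (verit) mult.assoc mult_left_mono)
qed

section \<open>Hessian accuracy of the composed models\<close>

theorem theorem33:
  fixes f1 :: "real^'d \<Rightarrow> real^'m" and f2 :: "real^'m \<Rightarrow> real"
    and ft1 :: "real \<Rightarrow> real^'d \<Rightarrow> real^'m" and ft2 :: "real \<Rightarrow> real^'m \<Rightarrow> real"
    and F :: "real^'d \<Rightarrow> real" and Ft :: "real \<Rightarrow> real^'d \<Rightarrow> real"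
    and x0 :: "real^'d"
    and \<Delta>b N1g N1h N2g N2h NF \<kappa>1g \<kappa>1h \<kappa>2g \<kappa>2h :: real
  assumes "C2 f1" and "C2_scalar f2"
    and "\<Delta>b > 0"
    and "\<And>\<Delta>. \<Delta> \<in> {0<..\<Delta>b} \<Longrightarrow> twice_differentiable (ft1 \<Delta>)"
    and "\<And>\<Delta>. \<Delta> \<in> {0<..\<Delta>b} \<Longrightarrow> twice_differentiable_scalar (ft2 \<Delta>)"
    and "F = f2 \<circ> f1"
    and "\<And>\<Delta>. \<Delta> \<in> {0<..\<Delta>b} \<Longrightarrow> Ft \<Delta> = ft2 \<Delta> \<circ> ft1 \<Delta>"
    and "N1g \<ge> 0" "N1h \<ge> 0" "N2g \<ge> 0" "N2h \<ge> 0"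
    and "\<kappa>1g \<ge> 0" "\<kappa>1h \<ge> 0" "\<kappa>2g \<ge> 0" "\<kappa>2h \<ge> 0"
    and "exact_function_accuracy ft1 \<Delta>b f1 x0"
    and "gradient_accuracy ft1 \<Delta>b f1 x0 N1g \<kappa>1g"
    and "hessian_accuracy ft1 \<Delta>b f1 x0 N1h \<kappa>1h"
    and "exact_function_accuracy ft2 \<Delta>b f2 (f1 x0)"
    and "gradient_accuracy_scalar ft2 \<Delta>b f2 (f1 x0) N2g \<kappa>2g"
    and "hessian_accuracy_scalar ft2 \<Delta>b f2 (f1 x0) N2h \<kappa>2h"
    and "NF = Min {N1g, N2g, N1h, N2h}"
  shows "bdd_above ((\<lambda>\<Delta>. matrix_norm (jacobian (ft1 \<Delta>) (at x0))) ` {0<..\<Delta>b}) \<and>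
    bdd_above ((\<lambda>\<Delta>. bilinear_norm (second_derivative (ft1 \<Delta>) x0)) ` {0<..\<Delta>b}) \<and>
    bdd_above ((\<lambda>\<Delta>. norm (gradient (ft2 \<Delta>) (f1 x0))) ` {0<..\<Delta>b}) \<and>
    bdd_above ((\<lambda>\<Delta>. matrix_norm (hessian (ft2 \<Delta>) (f1 x0))) ` {0<..\<Delta>b}) \<and>
    (\<forall>M1g M1h M2g M2h :: real.
      (\<forall>\<Delta>\<in>{0<..\<Delta>b}. matrix_norm (jacobian (ft1 \<Delta>) (at x0)) \<le> M1g) \<longrightarrow>
      (\<forall>\<Delta>\<in>{0<..\<Delta>b}. bilinear_norm (second_derivative (ft1 \<Delta>) x0) \<le> M1h) \<longrightarrow>
      (\<forall>\<Delta>\<in>{0<..\<Delta>b}. norm (gradient (ft2 \<Delta>) (f1 x0)) \<le> M2g) \<longrightarrow>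
      (\<forall>\<Delta>\<in>{0<..\<Delta>b}. matrix_norm (hessian (ft2 \<Delta>) (f1 x0)) \<le> M2h) \<longrightarrow>
      (\<forall>\<Delta>\<in>{0<..\<Delta>b}.
        matrix_norm (hessian F x0 - hessian (Ft \<Delta>) x0) \<le>
          (M2h * (matrix_norm (jacobian f1 (at x0)) + M1g) * \<kappa>1g * \<Delta>b powr (N1g - NF)
           + M1h * \<kappa>2g * \<Delta>b powr (N2g - NF)
           + (norm (gradient f2 (f1 x0)) + M2g) * \<kappa>1h * \<Delta>b powr (N1h - NF)
           + (matrix_norm (jacobian f1 (at x0)))\<^sup>2 * \<kappa>2h * \<Delta>b powr (N2h - NF))
          * \<Delta> powr NF)) \<and>
    (\<exists>\<kappa>\<ge>0. hessian_accuracy_scalar Ft \<Delta>b F x0 NF \<kappa>)"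
proof -
  note f1 = \<open>C2 f1\<close>[unfolded C2_def, THEN conjunct1]
    and f2 = \<open>C2_scalar f2\<close>[unfolded C2_scalar_def, THEN conjunct1]
    and t1 = assms(4) and t2 = assms(5) and \<kappa> = assms(12-15) and N = assms(8-11)
  let ?J = "jacobian f1 (at x0)" and ?J' = "\<lambda>\<Delta>. jacobian (ft1 \<Delta>) (at x0)"
  let ?B = "second_derivative f1 x0" and ?B' = "\<lambda>\<Delta>. second_derivative (ft1 \<Delta>) x0"
  let ?g = "gradient f2 (f1 x0)" and ?g' = "\<lambda>\<Delta>. gradient (ft2 \<Delta>) (f1 x0)"
  let ?H = "hessian f2 (f1 x0)" and ?H' = "\<lambda>\<Delta>. hessian (ft2 \<Delta>) (f1 x0)"
  let ?K = "\<lambda>M1g M1h M2g M2h. M2h * (matrix_norm ?J + M1g) * \<kappa>1g * \<Delta>b powr (N1g - NF)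
           + M1h * \<kappa>2g * \<Delta>b powr (N2g - NF)
           + (norm ?g + M2g) * \<kappa>1h * \<Delta>b powr (N1h - NF)
           + (matrix_norm ?J)\<^sup>2 * \<kappa>2h * \<Delta>b powr (N2h - NF)"
  have dJ: "matrix_norm (?J - ?J' \<Delta>) \<le> \<kappa>1g * \<Delta> powr N1g"
    and dB: "bilinear_norm (\<lambda>u w. ?B u w - ?B' \<Delta> u w) \<le> \<kappa>1h * \<Delta> powr N1h"
    and dg: "norm (?g - ?g' \<Delta>) \<le> \<kappa>2g * \<Delta> powr N2g"
    and dH: "matrix_norm (?H - ?H' \<Delta>) \<le> \<kappa>2h * \<Delta> powr N2h"
    and bB': "bounded_bilinear (?B' \<Delta>)"
    and same: "ft1 \<Delta> x0 = f1 x0"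
    if "\<Delta> \<in> {0<..\<Delta>b}" for \<Delta>
    using assms(16-18,20,21) that
    by (auto simp: gradient_accuracy_def hessian_accuracy_def gradient_accuracy_scalar_def
        hessian_accuracy_scalar_def exact_function_accuracy_def
        intro: bounded_bilinear_second_derivative t1)
  have bB: "bounded_bilinear ?B"
    by (rule bounded_bilinear_second_derivative[OF f1])

  have bdd1g: "bdd_above ((\<lambda>\<Delta>. matrix_norm (?J' \<Delta>)) ` {0<..\<Delta>b})"
    by (rule bdd_above_accuracy[OF matrix_norm_le_add_diff dJ N(1) \<kappa>(1)])
  have bdd1h: "bdd_above ((\<lambda>\<Delta>. bilinear_norm (?B' \<Delta>)) ` {0<..\<Delta>b})"
    by (rule bdd_above_accuracy[OF bilinear_norm_le_add_diff[OF bB bB'] dB N(2) \<kappa>(2)])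
  have bdd2g: "bdd_above ((\<lambda>\<Delta>. norm (?g' \<Delta>)) ` {0<..\<Delta>b})"
    \<comment> \<open>The triangle inequality used here has the difference model minus exact, so the
      error is flipped first.\<close>
    by (rule bdd_above_accuracy[OF norm_triangle_sub dg[unfolded norm_minus_commute[of ?g]] N(3) \<kappa>(3)])
  have bdd2h: "bdd_above ((\<lambda>\<Delta>. matrix_norm (?H' \<Delta>)) ` {0<..\<Delta>b})"
    by (rule bdd_above_accuracy[OF matrix_norm_le_add_diff dH N(4) \<kappa>(4)])

  have NF: "NF \<le> N1g" "NF \<le> N2g" "NF \<le> N1h" "NF \<le> N2h"
    by (simp_all add: \<open>NF = _\<close>)
  have bound: "matrix_norm (hessian F x0 - hessian (Ft \<Delta>) x0) \<le> ?K M1g M1h M2g M2h * \<Delta> powr NF"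
    if M1g: "\<forall>\<Delta>\<in>{0<..\<Delta>b}. matrix_norm (?J' \<Delta>) \<le> M1g"
      and M1h: "\<forall>\<Delta>\<in>{0<..\<Delta>b}. bilinear_norm (?B' \<Delta>) \<le> M1h"
      and M2g: "\<forall>\<Delta>\<in>{0<..\<Delta>b}. norm (?g' \<Delta>) \<le> M2g"
      and M2h: "\<forall>\<Delta>\<in>{0<..\<Delta>b}. matrix_norm (?H' \<Delta>) \<le> M2h"
      and \<Delta>: "\<Delta> \<in> {0<..\<Delta>b}" for M1g M1h M2g M2h \<Delta>
  proof -
    have \<Delta>': "0 < \<Delta>" "\<Delta> \<le> \<Delta>b" using \<Delta> by auto
    \<comment> \<open>Each \<open>M\<close> dominates a norm at the given \<open>\<Delta>\<close>.
      The signs allow factors to be replaced by larger ones below.\<close>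
    have nonneg: "0 \<le> M1g" "0 \<le> M1h" "0 \<le> M2g" "0 \<le> M2h"
      by (rule order_trans[OF _ M1g[rule_format, OF \<Delta>]] order_trans[OF _ M1h[rule_format, OF \<Delta>]]
          order_trans[OF _ M2g[rule_format, OF \<Delta>]] order_trans[OF _ M2h[rule_format, OF \<Delta>]],
          simp add: matrix_norm_nonneg bilinear_norm_nonneg[OF bB'[OF \<Delta>]])+
    have "matrix_norm (hessian F x0 - hessian (Ft \<Delta>) x0) \<le>
        matrix_norm (?H' \<Delta>) * (matrix_norm ?J + matrix_norm (?J' \<Delta>)) * matrix_norm (?J - ?J' \<Delta>)
        + bilinear_norm (?B' \<Delta>) * norm (?g - ?g' \<Delta>)
        + norm ?g * bilinear_norm (\<lambda>u w. ?B u w - ?B' \<Delta> u w)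
        + (matrix_norm ?J)\<^sup>2 * matrix_norm (?H - ?H' \<Delta>)"
      using matrix_norm_hessian_compose_diff_le[OF f1 f2 t1[OF \<Delta>] t2[OF \<Delta>] same[OF \<Delta>]]
      by (simp add: assms(6) assms(7)[OF \<Delta>])
    \<comment> \<open>Model norms give way to their bounds and all errors are brought to order
      \<open>NF\<close>. The coefficient \<open>norm ?g\<close> grows to
      \<open>norm ?g + M2g\<close>, as in the stated constant, because \<open>M2g\<close> is
      nonnegative.\<close>
    also have "\<dots> \<le> M2h * (matrix_norm ?J + M1g) * (\<kappa>1g * \<Delta>b powr (N1g - NF) * \<Delta> powr NF)
        + M1h * (\<kappa>2g * \<Delta>b powr (N2g - NF) * \<Delta> powr NF)
        + (norm ?g + M2g) * (\<kappa>1h * \<Delta>b powr (N1h - NF) * \<Delta> powr NF)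
        + (matrix_norm ?J)\<^sup>2 * (\<kappa>2h * \<Delta>b powr (N2h - NF) * \<Delta> powr NF)"
      using M1g M1h M2g M2h \<Delta> nonneg \<kappa>
      by (intro add_mono mult_mono accuracy_order_mono[OF dJ[OF \<Delta>] \<Delta>' NF(1)]
          accuracy_order_mono[OF dg[OF \<Delta>] \<Delta>' NF(2)] accuracy_order_mono[OF dB[OF \<Delta>] \<Delta>' NF(3)]
          accuracy_order_mono[OF dH[OF \<Delta>] \<Delta>' NF(4)])
        (auto simp: matrix_norm_nonneg bilinear_norm_nonneg[OF bounded_bilinear_diff[OF bB bB'[OF \<Delta>]]])
    also have "\<dots> = ?K M1g M1h M2g M2h * \<Delta> powr NF"
      by (simp add: algebra_simps)
    finally show ?thesis .
  qed

  have "\<exists>\<kappa>\<ge>0. hessian_accuracy_scalar Ft \<Delta>b F x0 NF \<kappa>"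
  proof -
    obtain M1g M1h M2g M2h where
      M: "\<forall>\<Delta>\<in>{0<..\<Delta>b}. matrix_norm (?J' \<Delta>) \<le> M1g"
        "\<forall>\<Delta>\<in>{0<..\<Delta>b}. bilinear_norm (?B' \<Delta>) \<le> M1h"
        "\<forall>\<Delta>\<in>{0<..\<Delta>b}. norm (?g' \<Delta>) \<le> M2g"
        "\<forall>\<Delta>\<in>{0<..\<Delta>b}. matrix_norm (?H' \<Delta>) \<le> M2h"
      using bdd1g bdd1h bdd2g bdd2h unfolding bdd_above_def ball_simps by metis
    let ?\<kappa> = "?K M1g M1h M2g M2h"
    \<comment> \<open>At \<open>\<Delta> = \<Delta>b\<close> the bound dominates a norm; the
      positive power then cancels and leaves the sign of the constant.\<close>
    have "0 \<le> ?\<kappa> * \<Delta>b powr NF"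
      by (rule order_trans[OF matrix_norm_nonneg bound[OF M]]) (use \<open>0 < \<Delta>b\<close> in simp)
    then have "0 \<le> ?\<kappa>"
      using \<open>0 < \<Delta>b\<close> by (simp add: zero_le_mult_iff)
    moreover have "hessian_accuracy_scalar Ft \<Delta>b F x0 NF ?\<kappa>"
      \<comment> \<open>Accuracy also demands twice differentiable models, a property that
        composition preserves.\<close>
      unfolding hessian_accuracy_scalar_def
      using bound[OF M] twice_differentiable_scalar_compose[OF t1 t2] assms(7) by simp
    ultimately show ?thesis by blast
  qed
  with bdd1g bdd1h bdd2g bdd2h bound show ?thesis by blast
qed

end
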